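(* If $A$ is a finite $2$-coloured linear order in which all points have distinct $2$-characters, then $|A|\le 70$.
   Context: A finite $2$-coloured linear order is a finite linear order $(A,<)$ with a colouring $F$ of its points by two colours $r,b$. In the $n$-move Ehrenfeucht-Fraïssé game on coloured linear orders $A$ and $B$, players I and II move alternately, I first; on each move I picks an element of either structure and II responds with an element of the other structure. After $n$ moves elements $a_1,\dots,a_n\in A$ and $b_1,\dots,b_n\in B$ have been chosen, and II wins if $a_i\mapsto b_i$ is an order- and colour-isomorphism. $A\equiv_n B$ means that II has a winning strategy. For $a\in A$ let $A^{<a}=\{x\in A:x<a\}$ and $A^{>a}=\{x\in A:x>a\}$ with the induced order and colouring. The $n$-character of $a$ in $A$ is the triple consisting of the $\equiv_n$-class of $A^{<a}$, the $\equiv_n$-class of $A^{>a}$, and the colour $F(a)$; two points have the same $n$-character iff all three components agree. *)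

theory Defs
  imports Main
begin

datatype colour = Red | Blue

record 'a coloured_order =
  points :: "'a set"
  lt :: "'a \<Rightarrow> 'a \<Rightarrow> bool"
  col :: "'a \<Rightarrow> colour"

(* Only the values of lt and col on points matter. *)
definition coloured_linear_order :: "'a coloured_order \<Rightarrow> bool" where
  "coloured_linear_order A \<longleftrightarrow>
     irreflp_on (points A) (lt A) \<and> transp_on (points A) (lt A) \<and> totalp_on (points A) (lt A)"

definition below :: "'a coloured_order \<Rightarrow> 'a \<Rightarrow> 'a coloured_order" where
  "below A a = A\<lparr>points := {x \<in> points A. lt A x a}\<rparr>"

definition above :: "'a coloured_order \<Rightarrow> 'a \<Rightarrow> 'a coloured_order" where
  "above A a = A\<lparr>points := {x \<in> points A. lt A a x}\<rparr>"

(* A move of player I is Inl a (a point of A) or Inr b (a point of B).  A strategy of player II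
   is a pair (s, t): after player I has made the moves ms, II answers with t ms in B if the last
   of these was made in A, and with s ms in A if it was made in B.  The value of play_round is the
   pair (a_i, b_i) resulting from the move number i, counted from 0. *)
definition play_round ::
  "(('a + 'b) list \<Rightarrow> 'a) \<Rightarrow> (('a + 'b) list \<Rightarrow> 'b) \<Rightarrow> ('a + 'b) list \<Rightarrow> nat \<Rightarrow> 'a \<times> 'b" where
  "play_round s t ms i =
     (case ms ! i of
        Inl a \<Rightarrow> (a, t (take (Suc i) ms))
      | Inr b \<Rightarrow> (s (take (Suc i) ms), b))"

(* The list ps consists of the pairs (a_i, b_i); player II wins iff a_i -> b_i is a well-defined
   injection from points of A to points of B preserving order and colour. *)
definition II_wins :: "'a coloured_order \<Rightarrow> 'b coloured_order \<Rightarrow> ('a \<times> 'b) list \<Rightarrow> bool" where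
  "II_wins A B ps \<longleftrightarrow>
     set ps \<subseteq> points A \<times> points B \<and>
     (\<forall>(a, b) \<in> set ps. col A a = col B b) \<and>
     (\<forall>(a, b) \<in> set ps. \<forall>(a', b') \<in> set ps.
        (a = a' \<longleftrightarrow> b = b') \<and> (lt A a a' \<longleftrightarrow> lt B b b'))"

definition ef_equiv :: "nat \<Rightarrow> 'a coloured_order \<Rightarrow> 'b coloured_order \<Rightarrow> bool" where
  "ef_equiv n A B \<longleftrightarrow>
     (\<exists>s t. \<forall>ms. length ms = n \<and> set ms \<subseteq> points A <+> points B \<longrightarrow>
        II_wins A B (map (play_round s t ms) [0..<n]))"

definition ef_class :: "nat \<Rightarrow> 'a coloured_order \<Rightarrow> 'a coloured_order set" where
  "ef_class n A = {B. coloured_linear_order B \<and> ef_equiv n A B}"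

definition n_character ::
  "nat \<Rightarrow> 'a coloured_order \<Rightarrow> 'a \<Rightarrow> 'a coloured_order set \<times> 'a coloured_order set \<times> colour" where
  "n_character n A a = (ef_class n (below A a), ef_class n (above A a), col A a)"

end

theory Submission
  imports Defs
begin

text \<open>A position in a word \<open>w\<close> over the two colours has a 1-character: the set of colours before it, its own
colour, and the set of colours after it. Two orders are equivalent for the two-move game iff the
same 1-characters occur in them (\<open>ef_equiv_2_iff_order_chars\<close>), so a finite order is just a word, and
the hypothesis says that the word is irreducible: two positions of the same colour never have both
equivalent left parts and equivalent right parts.

Two observations bound the length of such a word. First, equivalence does not count far: \<open>u z z z\<close> is
equivalent to \<open>u z z z z\<close>, and \<open>u z z\<close> to \<open>u z z z\<close> if both colours occur in \<open>u\<close>. Hence in an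
irreducible word a block of 8 consecutive letters is never constant; neither are the first 7 letters
if both colours follow, nor 6 letters with both colours on either side. It follows that the first
19 = 7 + 6 + 6 letters of a long enough word form three blocks, each containing both colours.

Secondly, call a word saturated if each colour occurs at some position that has both colours on either
side; three such blocks in a row are saturated. The class of a saturated word depends only on its
first two and last two letters (\<open>word_chars_saturated_cong\<close>). So at a position with at least 19
letters on either side, the left part and the right part are both saturated, and only the window of five
letters around the position matters. Irreducibility leaves at most \<open>2 ^ 5 = 32\<close> such positions, and
in total at most 19 + 32 + 19 = 70.\<close>

section \<open>Words and their 1-characters\<close>

definition word_chars :: "colour list \<Rightarrow> (colour set \<times> colour \<times> colour set) set" where
  "word_chars w = {(set p, x, set q) | p x q. w = p @ x # q}"

lemma word_charsI: "w = p @ x # q \<Longrightarrow> (set p, x, set q) \<in> word_chars w"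
  unfolding word_chars_def by blast

lemma word_chars_snoc:
  "word_chars (w @ [z]) =
     (\<lambda>(a, x, b). (a, x, insert z b)) ` word_chars w \<union> {(set w, z, {})}" (is "?L = ?R")
proof
  show "?L \<subseteq> ?R"
  proof
    fix t assume "t \<in> ?L"
    then obtain p x q where t: "t = (set p, x, set q)" and w: "w @ [z] = p @ x # q"
      by (auto simp: word_chars_def)
    show "t \<in> ?R"
    proof (cases q rule: rev_cases)
      case Nil
      then show ?thesis using t w by auto
    next
      case (snoc q' y)
      then have "w = p @ x # q'" "y = z" using w by auto
      then have "(set p, x, set q') \<in> word_chars w" by (auto simp: word_chars_def)
      then show ?thesis using t snoc \<open>y = z\<close> by force
    qed
  qed
  show "?R \<subseteq> ?L"
  proof -
    have "(set p, x, insert z (set q)) \<in> ?L" if "w = p @ x # q" for p x q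
      using that word_charsI[of "w @ [z]" p x "q @ [z]"] by simp
    moreover have "(set w, z, {}) \<in> ?L"
      using word_charsI[of "w @ [z]" w z "[]"] by simp
    ultimately show ?thesis by (auto simp: word_chars_def)
  qed
qed

lemma word_chars_rev:
  "(a, x, b) \<in> word_chars (rev w) \<longleftrightarrow> (b, x, a) \<in> word_chars w"
proof -
  have imp: "(b, x, a) \<in> word_chars (rev w)" if "(a, x, b) \<in> word_chars w" for a b w
  proof -
    obtain p q where "w = p @ x # q" "a = set p" "b = set q"
      using \<open>(a, x, b) \<in> word_chars w\<close> by (auto simp: word_chars_def)
    then show ?thesis
      unfolding word_chars_def
      by (intro CollectI exI[of _ "rev q"] exI[of _ x] exI[of _ "rev p"]) simp
  qed
  show ?thesis using imp[of a b "rev w"] imp[of b a w] by auto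
qed

text \<open>Reversal lets every statement about the right end of a word be transferred to the left end.\<close>

lemma word_chars_rev_eq_iff:
  "word_chars (rev u) = word_chars (rev v) \<longleftrightarrow> word_chars u = word_chars v"
  by (auto simp: set_eq_iff word_chars_rev)

text \<open>In a final run of \<open>z\<close>, the colours before a position are the same from the second position of the
run on, and the colours after it are the same up to the last but one. So only the first, a middle and
the last position of the run can differ, and a fourth repetition adds nothing. If both colours occur
before the run, the first position is no different from a middle one, and two repetitions suffice.\<close>

lemma word_chars_pump:
  "word_chars (u @ [z, z, z]) = word_chars (u @ [z, z, z, z])"
proof -
  have 1: "u @ [z, z, z] = ((u @ [z]) @ [z]) @ [z]"
    and 2: "u @ [z, z, z, z] = (((u @ [z]) @ [z]) @ [z]) @ [z]" by simp_all
  show ?thesis unfolding 1 2 word_chars_snoc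
    by (simp add: image_Un image_image split_beta insert_commute)
qed

lemma word_chars_pump_full:
  assumes "set u = UNIV"
  shows "word_chars (u @ [z, z]) = word_chars (u @ [z, z, z])"
proof -
  have 1: "u @ [z, z] = (u @ [z]) @ [z]"
    and 2: "u @ [z, z, z] = ((u @ [z]) @ [z]) @ [z]" by simp_all
  show ?thesis unfolding 1 2 word_chars_snoc
    by (simp add: assms image_Un image_image split_beta insert_commute)
qed

lemma word_chars_pump_left:
  "word_chars ([z, z, z] @ v) = word_chars ([z, z, z, z] @ v)"
  using word_chars_pump[of "rev v" z] word_chars_rev_eq_iff[of "[z, z, z] @ v" "[z, z, z, z] @ v"]
  by simp

lemma word_chars_pump_full_left:
  assumes "set v = UNIV"
  shows "word_chars ([z, z] @ v) = word_chars ([z, z, z] @ v)"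
  using word_chars_pump_full[of "rev v" z] word_chars_rev_eq_iff[of "[z, z] @ v" "[z, z, z] @ v"]
    assms by simp

section \<open>Irreducible words\<close>

definition irreducible_word :: "colour list \<Rightarrow> bool" where
  "irreducible_word w \<longleftrightarrow>
     (\<forall>p q p' q' x. w = p @ x # q \<longrightarrow> w = p' @ x # q' \<longrightarrow>
        word_chars p = word_chars p' \<longrightarrow> word_chars q = word_chars q' \<longrightarrow> p = p')"

lemma irreducible_wordD:
  assumes "irreducible_word w" and "w = p @ x # q" and "w = p' @ x # q'"
    and "word_chars p = word_chars p'" and "word_chars q = word_chars q'"
  shows "p = p'"
  using assms(1)[unfolded irreducible_word_def, rule_format, OF assms(2-5)] .

lemma irreducible_word_rev:
  assumes "irreducible_word w"
  shows "irreducible_word (rev w)"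
  unfolding irreducible_word_def
proof (intro allI impI)
  fix p q p' q' x
  assume w: "rev w = p @ x # q" "rev w = p' @ x # q'"
    and eq: "word_chars p = word_chars p'" "word_chars q = word_chars q'"
  have "w = rev q @ x # rev p" "w = rev q' @ x # rev p'"
    using w[THEN arg_cong, of rev] by simp_all
  moreover have "word_chars (rev q) = word_chars (rev q')" "word_chars (rev p) = word_chars (rev p')"
    using eq by (simp_all add: word_chars_rev_eq_iff)
  ultimately have "rev q = rev q'"
    using irreducible_wordD[OF assms] by metis
  then show "p = p'" using w(1) unfolding w(2) by simp
qed

text \<open>Where two equal letters are adjacent, passing from the first to the second moves one letter from the
right part to the left part. Irreducibility forbids that this is invisible on both sides.\<close>

lemma irreducible_word_no_pump:
  assumes "irreducible_word w" and "w = p @ [z, z] @ q"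
    and "word_chars p = word_chars (p @ [z])" and "word_chars q = word_chars ([z] @ q)"
  shows False
proof -
  have "w = p @ z # ([z] @ q)" "w = (p @ [z]) @ z # q" using assms(2) by simp_all
  then have "p = p @ [z]"
    using assms(3) assms(4)[symmetric] by (rule irreducible_wordD[OF assms(1)])
  then show False by simp
qed

lemma UNIV_colour: "UNIV = {Red, Blue}"
  using colour.exhaust by auto

lemma not_full_imp_replicate:
  assumes "set w \<noteq> (UNIV :: colour set)"
  shows "\<exists>z. w = replicate (length w) z"
proof -
  obtain y where "y \<notin> set w" using assms by auto
  then have "\<exists>z. \<forall>x\<in>set w. x = z" by (metis colour.exhaust)
  then show ?thesis by (metis replicate_length_same)
qed

text \<open>The lengths 8 = 3 + 2 + 3, 7 = 3 + 2 + 2 and 6 = 2 + 2 + 2 below arise from the two middle letters of a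
constant block together with the repetitions that make a further one invisible: three on a side in
general, two if both colours occur beyond the block on that side.\<close>

lemma block_8_full:
  assumes "irreducible_word w" and "w = u @ m @ v" and "length m = 8"
  shows "set m = UNIV"
proof (rule ccontr)
  assume "set m \<noteq> UNIV"
  then obtain z where "m = replicate 8 z" using not_full_imp_replicate assms(3) by metis
  then have "w = (u @ [z, z, z]) @ [z, z] @ ([z, z, z] @ v)"
    using assms(2) by (simp add: numeral_eq_Suc)
  then show False
    by (rule irreducible_word_no_pump[OF assms(1)])
      (use word_chars_pump[of u z] word_chars_pump_left[of z v] in simp_all)
qed

lemma initial_block_7_full:
  assumes "irreducible_word w" and "w = m @ v" and "length m = 7" and "set v = UNIV"
  shows "set m = UNIV"
proof (rule ccontr)
  assume "set m \<noteq> UNIV"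
  then obtain z where "m = replicate 7 z" using not_full_imp_replicate assms(3) by metis
  then have "w = ([] @ [z, z, z]) @ [z, z] @ ([z, z] @ v)"
    using assms(2) by (simp add: numeral_eq_Suc)
  then show False
    by (rule irreducible_word_no_pump[OF assms(1)])
      (use word_chars_pump[of "[]" z] word_chars_pump_full_left[OF assms(4), of z] in simp_all)
qed

lemma inner_block_6_full:
  assumes "irreducible_word w" and "w = u @ m @ v" and "length m = 6"
    and "set u = UNIV" and "set v = UNIV"
  shows "set m = UNIV"
proof (rule ccontr)
  assume "set m \<noteq> UNIV"
  then obtain z where "m = replicate 6 z" using not_full_imp_replicate assms(3) by metis
  then have "w = (u @ [z, z]) @ [z, z] @ ([z, z] @ v)"
    using assms(2) by (simp add: numeral_eq_Suc)
  then show False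
    by (rule irreducible_word_no_pump[OF assms(1)])
      (use word_chars_pump_full[OF assms(4), of z] word_chars_pump_full_left[OF assms(5), of z]
       in simp_all)
qed

section \<open>Saturated words\<close>

definition saturated :: "colour list \<Rightarrow> bool" where
  "saturated w \<longleftrightarrow> (\<forall>x. (UNIV, x, UNIV) \<in> word_chars w)"

lemma saturated_extend:
  assumes "saturated w"
  shows "saturated (u @ w @ v)"
  unfolding saturated_def
proof
  fix x
  obtain p q where "w = p @ x # q" "set p = UNIV" "set q = UNIV"
    using assms unfolding saturated_def word_chars_def by force
  then have "u @ w @ v = (u @ p) @ x # (q @ v)" "set (u @ p) = UNIV" "set (q @ v) = UNIV"
    by auto
  then show "(UNIV, x, UNIV) \<in> word_chars (u @ w @ v)"
    unfolding word_chars_def by (metis (mono_tags, lifting) mem_Collect_eq)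
qed

lemma saturated_rev: "saturated (rev w) \<longleftrightarrow> saturated w"
  by (simp add: saturated_def word_chars_rev)

lemma saturated_3_full_blocks:
  assumes "set u = UNIV" "set m = UNIV" "set v = UNIV"
  shows "saturated (u @ m @ v)"
  unfolding saturated_def
proof
  fix x
  obtain p q where "m = p @ x # q" using assms(2) by (metis UNIV_I split_list)
  then have "u @ m @ v = (u @ p) @ x # (q @ v)" "set (u @ p) = UNIV" "set (q @ v) = UNIV"
    using assms by auto
  then show "(UNIV, x, UNIV) \<in> word_chars (u @ m @ v)"
    unfolding word_chars_def by (metis (mono_tags, lifting) mem_Collect_eq)
qed

text \<open>The length 27 = 19 + 8 guarantees a block of 8 letters, and hence both colours, beyond the first 19
letters.\<close>

lemma irreducible_prefix_saturated:
  assumes irr: "irreducible_word w" and len: "27 \<le> length w"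
  shows "saturated (take 19 w)"
proof -
  define a where "a = take 7 w"
  define b where "b = take 6 (drop 7 w)"
  define c where "c = take 6 (drop 13 w)"
  define d where "d = drop 19 w"
  have ab: "drop 7 w = b @ drop 13 w"
    unfolding b_def using append_take_drop_id[of 6 "drop 7 w"] by simp
  have cd: "drop 13 w = c @ d"
    unfolding c_def d_def using append_take_drop_id[of 6 "drop 13 w"] by simp
  have w: "w = a @ b @ c @ d"
    using append_take_drop_id[of 7 w] ab cd unfolding a_def by simp
  have l: "length a = 7" "length b = 6" "length c = 6" "8 \<le> length d"
    using len by (simp_all add: a_def b_def c_def d_def)
  have "set (take 8 d) = UNIV"
    using block_8_full[OF irr, of "a @ b @ c" "take 8 d" "drop 8 d"] w l by simp
  then have d: "set d = UNIV" using set_take_subset[of 8 d] by auto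
  have a: "set a = UNIV"
    using initial_block_7_full[OF irr, of a "b @ c @ d"] w l d by auto
  have b: "set b = UNIV"
    using inner_block_6_full[OF irr, of a b "c @ d"] w l a d by auto
  have c: "set c = UNIV"
    using inner_block_6_full[OF irr, of "a @ b" c d] w l a d by auto
  have "take 19 w = a @ b @ c" using w l by simp
  then show ?thesis using saturated_3_full_blocks[OF a b c] by simp
qed

text \<open>These pairs come from the positions of the first run and the position right after it. The
colours after the position are dropped: in a saturated word they are always both colours.\<close>

definition initial_chars :: "colour list \<Rightarrow> (colour set \<times> colour) set" where
  "initial_chars w = {(a, x). a \<noteq> UNIV \<and> (\<exists>b. (a, x, b) \<in> word_chars w)}"

lemma initial_charsI:
  "w = p @ x # q \<Longrightarrow> set p \<noteq> UNIV \<Longrightarrow> (set p, x) \<in> initial_chars w"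
  using word_charsI[of w p x q] unfolding initial_chars_def by auto

lemma singleton_not_full: "{x} \<noteq> (UNIV :: colour set)"
  by (cases x) (auto simp: UNIV_colour)

text \<open>Before both colours have been seen, the word has the form \<open>x ... x z\<close>. The only information that
the pairs carry, beyond the first letter, is whether \<open>x\<close> is repeated.\<close>

lemma initial_chars_eq:
  assumes full: "set w = UNIV" and w: "w = x # y # v"
  shows "initial_chars w = {({}, x)} \<union> {({x}, z) | z. x = y \<or> z = y}" (is "?L = ?R")
proof
  show "?L \<subseteq> ?R"
  proof
    fix t assume "t \<in> ?L"
    then obtain p z q where t: "t = (set p, z)" "set p \<noteq> UNIV" and pq: "w = p @ z # q"
      by (auto simp: initial_chars_def word_chars_def)
    obtain c where c: "p = replicate (length p) c" using not_full_imp_replicate[OF t(2)] by blast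
    show "t \<in> ?R"
    proof (cases p)
      case Nil
      then show ?thesis using t pq w by simp
    next
      case (Cons c' p')
      then have "c' = x" using pq w by simp
      have "set p = {c}" using c Cons by (metis length_0_conv list.discI set_replicate)
      then have "set p = {x}" using Cons \<open>c' = x\<close> by auto
      moreover have "x = y \<or> z = y"
        using Cons pq w \<open>set p = {x}\<close> by (cases p') auto
      ultimately show ?thesis using t by simp
    qed
  qed
  have empty: "({}, x) \<in> ?L"
    using initial_charsI[of w "[]" x "y # v"] w by simp
  have second: "({x}, y) \<in> ?L"
    using initial_charsI[of w "[x]" y v] w singleton_not_full[of x] by simp
  have "({x}, z) \<in> ?L" if xy: "x = y \<or> z = y" for z
  proof (cases "z = y")
    case True
    then show ?thesis using second by simp
  next
    case False
    then have "x = y" using xy by simp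
    obtain p q where pq: "w = p @ z # q" "z \<notin> set p"
      using full split_list_first[of z w] by auto
    have "p \<noteq> []" using pq w False \<open>x = y\<close> by auto
    moreover have "\<forall>c\<in>set p. c = x"
      using pq(2) False \<open>x = y\<close> by (metis (full_types) colour.exhaust)
    ultimately have "set p = {x}" by (cases p) auto
    then show ?thesis using initial_charsI[OF pq(1)] singleton_not_full[of x] by simp
  qed
  with empty show "?R \<subseteq> ?L" by auto
qed

text \<open>In a saturated word, no position lacks a colour on both sides: a position of the same colour with both
colours on either side lies to the left or to the right of it. So the 1-characters split into those
seen from the left end, those seen from the right end, and the two that saturation provides.\<close>

lemma word_chars_saturated:
  assumes sat: "saturated w"
  shows "word_chars w = {(a, x, UNIV) | a x. (a, x) \<in> initial_chars w}
     \<union> {(UNIV, x, b) | b x. (b, x) \<in> initial_chars (rev w)} \<union> {(UNIV, x, UNIV) | x. True}"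
proof -
  have key: "set p = UNIV \<or> set q = UNIV" if pq: "w = p @ x # q" for p x q
  proof -
    obtain p' q' where pq': "w = p' @ x # q'" "set p' = UNIV" "set q' = UNIV"
      using sat unfolding saturated_def word_chars_def by force
    consider us where "p = p' @ us" | us where "us @ x # q' = x # q"
      using append_eq_append_conv2[of p' "x # q'" p "x # q"] pq pq'(1) by auto
    then show ?thesis
    proof cases
      case 1
      then show ?thesis using pq' by auto
    next
      case (2 us)
      then have "set q' \<subseteq> set q" by (cases us) auto
      then show ?thesis using pq' by auto
    qed
  qed
  have key': "a = UNIV \<or> b = UNIV" if "(a, x, b) \<in> word_chars w" for a x b
    using that key unfolding word_chars_def by auto
  have "(a, x, b) \<in> word_chars w \<longleftrightarrow> (b = UNIV \<and> (a, x) \<in> initial_chars w)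
      \<or> (a = UNIV \<and> (b, x) \<in> initial_chars (rev w)) \<or> (a = UNIV \<and> b = UNIV)" for a x b
    using key'[of a x b] key'[of a x] key'[of _ x b] sat
    unfolding initial_chars_def word_chars_rev saturated_def by auto
  then show ?thesis by auto
qed

lemma full_length_ge_2:
  assumes "set w = (UNIV :: colour set)"
  obtains x y v where "w = x # y # v"
proof -
  have "w \<noteq> []" "w \<noteq> [x]" for x using assms singleton_not_full[of x] by auto
  then show ?thesis using that by (metis neq_Nil_conv)
qed

lemma initial_chars_cong:
  assumes "set u = UNIV" and "set w = UNIV" and "take 2 u = take 2 w"
  shows "initial_chars u = initial_chars w"
proof -
  obtain x y v where u: "u = x # y # v" using full_length_ge_2[OF assms(1)] .
  obtain x' y' v' where w: "w = x' # y' # v'" using full_length_ge_2[OF assms(2)] .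
  have "x' = x" "y' = y" using assms(3) u w by simp_all
  then show ?thesis
    using initial_chars_eq[OF assms(1) u] initial_chars_eq[OF assms(2) w] by simp
qed

lemma saturated_full:
  assumes "saturated w"
  shows "set w = UNIV"
proof -
  have "(UNIV, Red, UNIV) \<in> word_chars w" using assms by (simp add: saturated_def)
  then obtain p q where "w = p @ Red # q" "set p = UNIV" by (auto simp: word_chars_def)
  then show ?thesis by simp
qed

lemma word_chars_saturated_cong:
  assumes sat: "saturated u" "saturated w"
    and eq: "take 2 u = take 2 w" "take 2 (rev u) = take 2 (rev w)"
  shows "word_chars u = word_chars w"
proof -
  have full: "set u = UNIV" "set w = UNIV" using sat saturated_full by auto
  have "initial_chars u = initial_chars w"
    using full eq(1) by (rule initial_chars_cong)
  moreover have "initial_chars (rev u) = initial_chars (rev w)"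
    using full eq(2) by (intro initial_chars_cong) simp_all
  ultimately show ?thesis
    unfolding word_chars_saturated[OF sat(1)] word_chars_saturated[OF sat(2)] by simp
qed

lemma irreducible_word_length:
  assumes irr: "irreducible_word w"
  shows "length w \<le> 70"
proof (rule ccontr)
  assume "\<not> length w \<le> 70"
  then have len: "71 \<le> length w" by simp
  define I where "I = {19..<length w - 19}"
  \<comment> \<open>the window of five letters centred at position \<open>i\<close>\<close>
  define f where "f i = take 5 (drop (i - 2) w)" for i
  have sat_take: "saturated (take k v)" if "irreducible_word v" "71 \<le> length v" "19 \<le> k" for k v
  proof -
    have "take k v = take 19 v @ take (k - 19) (drop 19 v)"
      using that take_add[of 19 "k - 19" v] by simp
    then show ?thesis
      using saturated_extend[of "take 19 v" "[]"] irreducible_prefix_saturated[of v] that by simp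
  qed
  have left: "saturated (take i w)" "take 2 (take i w) = take 2 w"
    "take 2 (rev (take i w)) = rev (take 2 (f i))" if "i \<in> I" for i
  proof -
    show "saturated (take i w)" using sat_take[OF irr len] that by (simp add: I_def)
    show "take 2 (take i w) = take 2 w" using that by (simp add: I_def min_def)
    have "take i w = take (i - 2) w @ take 2 (f i)"
      using take_add[of "i - 2" 2 w] le_add_diff_inverse2[of 2 i] that by (simp add: I_def f_def)
    moreover have "length (take 2 (f i)) = 2" using that by (auto simp: I_def f_def min_def)
    ultimately show "take 2 (rev (take i w)) = rev (take 2 (f i))" by simp
  qed
  have right: "saturated (drop (Suc i) w)" "take 2 (rev (drop (Suc i) w)) = take 2 (rev w)"
    "take 2 (drop (Suc i) w) = drop 3 (f i)" if "i \<in> I" for i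
  proof -
    have *: "rev (drop (Suc i) w) = take (length w - Suc i) (rev w)" by (rule rev_drop)
    have "19 \<le> length w - Suc i" using that by (auto simp: I_def)
    then have "saturated (rev (drop (Suc i) w))"
      unfolding * using sat_take[OF irreducible_word_rev[OF irr]] len by simp
    then show "saturated (drop (Suc i) w)" by (simp add: saturated_rev)
    show "take 2 (rev (drop (Suc i) w)) = take 2 (rev w)"
      unfolding * using \<open>19 \<le> length w - Suc i\<close> by (simp add: min_def)
    have "Suc (Suc (Suc (i - 2))) = Suc i" using that by (auto simp: I_def)
    then show "take 2 (drop (Suc i) w) = drop 3 (f i)"
      by (simp add: f_def drop_take numeral_eq_Suc)
  qed
  have "inj_on f I"
  proof
    fix i j assume ij: "i \<in> I" "j \<in> I" "f i = f j"
    have nth: "w ! k = f k ! 2" if "k \<in> I" for k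
    proof -
      have "k - 2 \<le> length w" "k - 2 + 2 = k" using that by (auto simp: I_def)
      then have "drop (k - 2) w ! 2 = w ! k" by (simp only: nth_drop)
      then show ?thesis by (simp add: f_def)
    qed
    have w: "w = take k w @ w ! k # drop (Suc k) w" if "k \<in> I" for k
      using that by (intro id_take_nth_drop) (auto simp: I_def)
    have "word_chars (take i w) = word_chars (take j w)"
      using left(1)[OF ij(1)] left(1)[OF ij(2)]
    proof (rule word_chars_saturated_cong)
      show "take 2 (take i w) = take 2 (take j w)"
        unfolding left(2)[OF ij(1)] left(2)[OF ij(2)] ..
      show "take 2 (rev (take i w)) = take 2 (rev (take j w))"
        unfolding left(3)[OF ij(1)] left(3)[OF ij(2)] ij(3) ..
    qed
    moreover have "word_chars (drop (Suc i) w) = word_chars (drop (Suc j) w)"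
      using right(1)[OF ij(1)] right(1)[OF ij(2)]
    proof (rule word_chars_saturated_cong)
      show "take 2 (drop (Suc i) w) = take 2 (drop (Suc j) w)"
        unfolding right(3)[OF ij(1)] right(3)[OF ij(2)] ij(3) ..
      show "take 2 (rev (drop (Suc i) w)) = take 2 (rev (drop (Suc j) w))"
        unfolding right(2)[OF ij(1)] right(2)[OF ij(2)] ..
    qed
    moreover have "w ! i = w ! j"
      unfolding nth[OF ij(1)] nth[OF ij(2)] ij(3) ..
    ultimately have "take i w = take j w"
      using irreducible_wordD[OF irr w[OF ij(1)], of "take j w" "drop (Suc j) w"] w[OF ij(2)]
      by simp
    then have "length (take i w) = length (take j w)" by simp
    then show "i = j" using ij by (auto simp: I_def)
  qed
  moreover have "f ` I \<subseteq> {xs. set xs \<subseteq> UNIV \<and> length xs = 5}"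
    by (auto simp: f_def I_def)
  moreover have fin: "finite (UNIV :: colour set)" "card (UNIV :: colour set) = 2"
    by (simp_all add: UNIV_colour)
  ultimately have "card I \<le> card {xs. set xs \<subseteq> (UNIV :: colour set) \<and> length xs = 5}"
    using finite_lists_length_eq[OF fin(1), of 5] by (intro card_inj_on_le)
  also have "\<dots> = 2 ^ 5"
    using card_lists_length_eq[OF fin(1), of 5] fin(2) by simp
  finally have "card I \<le> 32" by simp
  then show False using len by (simp add: I_def)
qed

section \<open>The two-move game\<close>

definition order_chars :: "'a coloured_order \<Rightarrow> (colour set \<times> colour \<times> colour set) set" where
  "order_chars X =
     (\<lambda>a. (col X ` points (below X a), col X a, col X ` points (above X a))) ` points X"

text \<open>II survives one more round after the pair \<open>(a, b)\<close>. The condition speaks of positions instead of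
strategies, so that the game becomes a back-and-forth condition.\<close>

definition one_move_equiv :: "'a coloured_order \<Rightarrow> 'b coloured_order \<Rightarrow> 'a \<Rightarrow> 'b \<Rightarrow> bool" where
  "one_move_equiv X Y a b \<longleftrightarrow>
     (\<forall>a' \<in> points X. \<exists>b'. II_wins X Y [(a, b), (a', b')]) \<and>
     (\<forall>b' \<in> points Y. \<exists>a'. II_wins X Y [(a, b), (a', b')])"

text \<open>A strategy yields the back-and-forth condition by letting I play each possible pair of moves;
conversely, choice functions for the two rounds are assembled into a strategy.\<close>

lemma ef_equiv_2_iff:
  "ef_equiv 2 X Y \<longleftrightarrow>
     (\<forall>a \<in> points X. \<exists>b. one_move_equiv X Y a b) \<and>
     (\<forall>b \<in> points Y. \<exists>a. one_move_equiv X Y a b)" (is "?L \<longleftrightarrow> ?R")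
proof
  have upt: "[0..<2] = [0, 1::nat]" by (simp add: upt_rec)
  show ?R if ?L
  proof -
    obtain s t where st: "\<And>ms. length ms = 2 \<Longrightarrow> set ms \<subseteq> points X <+> points Y \<Longrightarrow>
        II_wins X Y (map (play_round s t ms) [0, 1])"
      using \<open>?L\<close> unfolding ef_equiv_def upt by auto
    have "one_move_equiv X Y a (t [Inl a])" if a: "a \<in> points X" for a
      unfolding one_move_equiv_def
    proof (intro conjI ballI)
      fix a' assume "a' \<in> points X"
      then show "\<exists>b'. II_wins X Y [(a, t [Inl a]), (a', b')]"
        using st[of "[Inl a, Inl a']"] a by (auto simp: play_round_def)
    next
      fix b' assume "b' \<in> points Y"
      then show "\<exists>a'. II_wins X Y [(a, t [Inl a]), (a', b')]"
        using st[of "[Inl a, Inr b']"] a by (auto simp: play_round_def)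
    qed
    moreover have "one_move_equiv X Y (s [Inr b]) b" if b: "b \<in> points Y" for b
      unfolding one_move_equiv_def
    proof (intro conjI ballI)
      fix a' assume "a' \<in> points X"
      then show "\<exists>b'. II_wins X Y [(s [Inr b], b), (a', b')]"
        using st[of "[Inr b, Inl a']"] b by (auto simp: play_round_def)
    next
      fix b' assume "b' \<in> points Y"
      then show "\<exists>a'. II_wins X Y [(s [Inr b], b), (a', b')]"
        using st[of "[Inr b, Inr b']"] b by (auto simp: play_round_def)
    qed
    ultimately show ?R by blast
  qed
  show ?L if ?R
  proof -
    obtain f where f: "\<And>a. a \<in> points X \<Longrightarrow> one_move_equiv X Y a (f a)"
      using \<open>?R\<close> by metis
    obtain g where g: "\<And>b. b \<in> points Y \<Longrightarrow> one_move_equiv X Y (g b) b"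
      using \<open>?R\<close> by metis
    define h where "h a b a' = (SOME b'. II_wins X Y [(a, b), (a', b')])" for a b a'
    define k where "k a b b' = (SOME a'. II_wins X Y [(a, b), (a', b')])" for a b b'
    have h: "II_wins X Y [(a, b), (a', h a b a')]"
      if "one_move_equiv X Y a b" "a' \<in> points X" for a b a'
      using that someI_ex[of "\<lambda>b'. II_wins X Y [(a, b), (a', b')]"]
      unfolding one_move_equiv_def h_def by simp
    have k: "II_wins X Y [(a, b), (k a b b', b')]"
      if "one_move_equiv X Y a b" "b' \<in> points Y" for a b b'
      using that someI_ex[of "\<lambda>a'. II_wins X Y [(a, b), (a', b')]"]
      unfolding one_move_equiv_def k_def by simp
    define t where "t ms = (case ms of
        [Inl a] \<Rightarrow> f a
      | [Inl a, Inl a'] \<Rightarrow> h a (f a) a'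
      | [Inr b, Inl a'] \<Rightarrow> h (g b) b a')" for ms
    define s where "s ms = (case ms of
        [Inr b] \<Rightarrow> g b
      | [Inl a, Inr b'] \<Rightarrow> k a (f a) b'
      | [Inr b, Inr b'] \<Rightarrow> k (g b) b b')" for ms
    have "II_wins X Y (map (play_round s t ms) [0..<2])"
      if "length ms = 2" and ms: "set ms \<subseteq> points X <+> points Y" for ms
    proof -
      obtain m m' where "ms = [m, m']"
        using \<open>length ms = 2\<close> by (auto simp: numeral_eq_Suc length_Suc_conv)
      then show ?thesis
        using ms f g h k
        by (cases m; cases m') (auto simp: upt play_round_def s_def t_def)
    qed
    then show ?L unfolding ef_equiv_def by blast
  qed
qed

text \<open>With one move left, I can only reveal a colour that occurs on one side of \<open>a\<close> but not on the same
side of \<open>b\<close>, or conversely.\<close>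

lemma one_move_equiv_iff:
  assumes X: "coloured_linear_order X" and Y: "coloured_linear_order Y"
    and a: "a \<in> points X" and b: "b \<in> points Y"
  shows "one_move_equiv X Y a b \<longleftrightarrow>
     (col X ` points (below X a), col X a, col X ` points (above X a)) =
     (col Y ` points (below Y b), col Y b, col Y ` points (above Y b))" (is "?L \<longleftrightarrow> ?R")
proof
  assume ?L
  then have *: "\<And>a'. a' \<in> points X \<Longrightarrow> \<exists>b'. II_wins X Y [(a, b), (a', b')]"
    "\<And>b'. b' \<in> points Y \<Longrightarrow> \<exists>a'. II_wins X Y [(a, b), (a', b')]"
    unfolding one_move_equiv_def by auto
  have "col X a = col Y b" using *(1)[OF a] by (auto simp: II_wins_def)
  moreover have "col X ` points (below X a) = col Y ` points (below Y b)"
  proof (intro equalityI image_subsetI)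
    fix x assume "x \<in> points (below X a)"
    then show "col X x \<in> col Y ` points (below Y b)"
      using *(1)[of x] by (auto simp: below_def II_wins_def)
  next
    fix y assume "y \<in> points (below Y b)"
    then show "col Y y \<in> col X ` points (below X a)"
      using *(2)[of y] by (auto simp: below_def II_wins_def image_iff)
  qed
  moreover have "col X ` points (above X a) = col Y ` points (above Y b)"
  proof (intro equalityI image_subsetI)
    fix x assume "x \<in> points (above X a)"
    then show "col X x \<in> col Y ` points (above Y b)"
      using *(1)[of x] by (auto simp: above_def II_wins_def)
  next
    fix y assume "y \<in> points (above Y b)"
    then show "col Y y \<in> col X ` points (above X a)"
      using *(2)[of y] by (auto simp: above_def II_wins_def image_iff)
  qed
  ultimately show ?R by simp
next
  assume ?R
  then have c: "col X a = col Y b"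
    and lo: "col X ` points (below X a) = col Y ` points (below Y b)"
    and hi: "col X ` points (above X a) = col Y ` points (above Y b)" by auto
  have irr: "\<not> lt X x x" if "x \<in> points X" for x
    using X that by (auto simp: coloured_linear_order_def irreflp_on_def)
  have irr': "\<not> lt Y y y" if "y \<in> points Y" for y
    using Y that by (auto simp: coloured_linear_order_def irreflp_on_def)
  have asym: "\<not> lt X x' x" if "lt X x x'" "x \<in> points X" "x' \<in> points X" for x x'
    using X that irr unfolding coloured_linear_order_def by (metis transp_onD)
  have asym': "\<not> lt Y y' y" if "lt Y y y'" "y \<in> points Y" "y' \<in> points Y" for y y'
    using Y that irr' unfolding coloured_linear_order_def by (metis transp_onD)
  have eq: "II_wins X Y [(a, b), (a, b)]"
    using a b c irr irr' by (auto simp: II_wins_def)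
  have below: "II_wins X Y [(a, b), (x, y)]"
    if "x \<in> points (below X a)" "y \<in> points (below Y b)" "col X x = col Y y" for x y
  proof -
    have "x \<in> points X" "lt X x a" "y \<in> points Y" "lt Y y b"
      using that by (auto simp: below_def)
    moreover from this have "\<not> lt X a x" "\<not> lt Y b y" "a \<noteq> x" "b \<noteq> y"
      using asym[of x a] asym'[of y b] irr[OF a] irr'[OF b] a b by auto
    ultimately show ?thesis
      using that(3) a b c irr[OF a] irr'[OF b] irr[of x] irr'[of y] by (simp add: II_wins_def)
  qed
  have above: "II_wins X Y [(a, b), (x, y)]"
    if "x \<in> points (above X a)" "y \<in> points (above Y b)" "col X x = col Y y" for x y
  proof -
    have "x \<in> points X" "lt X a x" "y \<in> points Y" "lt Y b y"
      using that by (auto simp: above_def)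
    moreover from this have "\<not> lt X x a" "\<not> lt Y y b" "a \<noteq> x" "b \<noteq> y"
      using asym[of a x] asym'[of b y] irr[OF a] irr'[OF b] a b by auto
    ultimately show ?thesis
      using that(3) a b c irr[OF a] irr'[OF b] irr[of x] irr'[of y] by (simp add: II_wins_def)
  qed
  show ?L
    unfolding one_move_equiv_def
  proof (intro conjI ballI)
    fix x assume "x \<in> points X"
    then consider "x = a" | "x \<in> points (below X a)" | "x \<in> points (above X a)"
      using X a by (auto simp: coloured_linear_order_def below_def above_def dest: totalp_onD)
    then show "\<exists>y. II_wins X Y [(a, b), (x, y)]"
    proof cases
      case 1
      then show ?thesis using eq by blast
    next
      case 2
      then have "col X x \<in> col Y ` points (below Y b)" using lo by blast
      then show ?thesis using below[OF 2] by blast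
    next
      case 3
      then have "col X x \<in> col Y ` points (above Y b)" using hi by blast
      then show ?thesis using above[OF 3] by blast
    qed
  next
    fix y assume "y \<in> points Y"
    then consider "y = b" | "y \<in> points (below Y b)" | "y \<in> points (above Y b)"
      using Y b by (auto simp: coloured_linear_order_def below_def above_def dest: totalp_onD)
    then show "\<exists>x. II_wins X Y [(a, b), (x, y)]"
    proof cases
      case 1
      then show ?thesis using eq by blast
    next
      case 2
      then have "col Y y \<in> col X ` points (below X a)" using lo by blast
      then show ?thesis using below[OF _ 2] by force
    next
      case 3
      then have "col Y y \<in> col X ` points (above X a)" using hi by blast
      then show ?thesis using above[OF _ 3] by force
    qed
  qed
qed

lemma one_move_equiv_points_iff:
  assumes "one_move_equiv X Y a b"
  shows "a \<in> points X \<longleftrightarrow> b \<in> points Y"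
proof -
  have "a \<in> points X \<and> b \<in> points Y" if "II_wins X Y ((a, b) # ps)" for ps
    using conjunct1[OF that[unfolded II_wins_def]] by simp
  then show ?thesis using assms unfolding one_move_equiv_def by meson
qed

lemma ef_equiv_2_iff_order_chars:
  assumes X: "coloured_linear_order X" and Y: "coloured_linear_order Y"
  shows "ef_equiv 2 X Y \<longleftrightarrow> order_chars X = order_chars Y"
proof -
  let ?cX = "\<lambda>a. (col X ` points (below X a), col X a, col X ` points (above X a))"
  let ?cY = "\<lambda>b. (col Y ` points (below Y b), col Y b, col Y ` points (above Y b))"
  have "(\<exists>b. one_move_equiv X Y a b) \<longleftrightarrow> ?cX a \<in> order_chars Y" if a: "a \<in> points X" for a
  proof -
    have "(\<exists>b. one_move_equiv X Y a b) \<longleftrightarrow> (\<exists>b \<in> points Y. one_move_equiv X Y a b)"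
      using a one_move_equiv_points_iff[of X Y a] by blast
    also have "\<dots> \<longleftrightarrow> (\<exists>b \<in> points Y. ?cX a = ?cY b)"
      by (intro bex_cong refl one_move_equiv_iff[OF X Y a])
    finally show ?thesis unfolding order_chars_def image_iff .
  qed
  moreover have "(\<exists>a. one_move_equiv X Y a b) \<longleftrightarrow> ?cY b \<in> order_chars X"
    if b: "b \<in> points Y" for b
  proof -
    have "(\<exists>a. one_move_equiv X Y a b) \<longleftrightarrow> (\<exists>a \<in> points X. one_move_equiv X Y a b)"
      using b one_move_equiv_points_iff[of X Y _ b] by blast
    also have "\<dots> \<longleftrightarrow> (\<exists>a \<in> points X. ?cX a = ?cY b)"
      by (intro bex_cong refl one_move_equiv_iff[OF X Y _ b])
    also have "\<dots> \<longleftrightarrow> (\<exists>a \<in> points X. ?cY b = ?cX a)"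
      by (intro bex_cong refl eq_commute)
    finally show ?thesis unfolding order_chars_def image_iff .
  qed
  ultimately have "ef_equiv 2 X Y \<longleftrightarrow>
      (\<forall>a \<in> points X. ?cX a \<in> order_chars Y) \<and> (\<forall>b \<in> points Y. ?cY b \<in> order_chars X)"
    unfolding ef_equiv_2_iff by (simp only: cong: ball_cong)
  also have "\<dots> \<longleftrightarrow> order_chars X \<subseteq> order_chars Y \<and> order_chars Y \<subseteq> order_chars X"
    unfolding order_chars_def[of X] order_chars_def[of Y] image_subset_iff ..
  finally show ?thesis by (simp only: set_eq_subset)
qed

lemma ef_class_2_cong:
  assumes "coloured_linear_order X" "coloured_linear_order Y" "order_chars X = order_chars Y"
  shows "ef_class 2 X = ef_class 2 Y"
  using assms by (auto simp: ef_class_def ef_equiv_2_iff_order_chars)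

section \<open>From orders to words\<close>

lemma sorted_enumeration:
  assumes "finite S" and "irreflp_on S R" and "transp_on S R" and "totalp_on S R"
  shows "\<exists>xs. set xs = S \<and> distinct xs \<and> sorted_wrt R xs"
  using assms
proof (induction S rule: finite_psubset_induct)
  case (psubset S)
  show ?case
  proof (cases "S = {}")
    case True
    then show ?thesis by simp
  next
    case False
    have "asymp_on S R"
      using psubset.prems by (intro asymp_onI) (metis irreflp_onD transp_onD)
    then obtain m where m: "m \<in> S" "\<forall>x\<in>S. x \<noteq> m \<longrightarrow> \<not> R x m"
      using Finite_Set.bex_min_element[OF psubset.hyps _ psubset.prems(2) False] by blast
    have sub: "S - {m} \<subset> S" using m by auto
    then obtain xs where xs: "set xs = S - {m}" "distinct xs" "sorted_wrt R xs"
      using psubset.IH[OF sub] psubset.prems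
      by (meson Diff_subset irreflp_on_subset totalp_on_subset transp_on_subset)
    moreover have "R m x" if "x \<in> S - {m}" for x
      using that m psubset.prems(3) by (metis DiffE insertCI totalp_onD)
    ultimately have "set (m # xs) = S" "distinct (m # xs)" "sorted_wrt R (m # xs)" using m by auto
    then show ?thesis by blast
  qed
qed

lemma coloured_linear_order_subset:
  assumes "coloured_linear_order A" and "S \<subseteq> points A"
  shows "coloured_linear_order (A\<lparr>points := S\<rparr>)"
  using assms unfolding coloured_linear_order_def
  by (auto intro: irreflp_on_subset transp_on_subset totalp_on_subset)

lemma points_split:
  assumes A: "coloured_linear_order A" and xs: "set (p @ x # q) = points A"
    "sorted_wrt (lt A) (p @ x # q)"
  shows "points (below A x) = set p" and "points (above A x) = set q"
proof -
  have asym: "\<not> lt A b a" if "lt A a b" "a \<in> points A" "b \<in> points A" for a b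
    using A that unfolding coloured_linear_order_def by (metis irreflp_onD transp_onD)
  have irrefl: "\<not> lt A x x"
    using A xs(1) unfolding coloured_linear_order_def by (auto dest: irreflp_onD)
  have lo: "lt A y x" if "y \<in> set p" for y using xs(2) that by (simp add: sorted_wrt_append)
  have hi: "lt A x y" if "y \<in> set q" for y using xs(2) that by (simp add: sorted_wrt_append)
  have pts: "y \<in> points A \<longleftrightarrow> y \<in> set p \<or> y = x \<or> y \<in> set q" for y using xs(1) by auto
  have "y \<in> points (below A x) \<longleftrightarrow> y \<in> set p" for y
    using irrefl lo[of y] hi[of y] asym[of x y] pts[of y] pts[of x] by (auto simp: below_def)
  then show "points (below A x) = set p" by blast
  have "y \<in> points (above A x) \<longleftrightarrow> y \<in> set q" for y
    using irrefl lo[of y] hi[of y] asym[of y x] pts[of y] pts[of x] by (auto simp: above_def)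
  then show "points (above A x) = set q" by blast
qed

lemma order_chars_eq_word_chars:
  assumes X: "coloured_linear_order X" and xs: "set xs = points X" "sorted_wrt (lt X) xs"
  shows "order_chars X = word_chars (map (col X) xs)"
proof (intro equalityI subsetI)
  fix c assume "c \<in> order_chars X"
  then obtain x where x: "x \<in> set xs"
    "c = (col X ` points (below X x), col X x, col X ` points (above X x))"
    using xs by (auto simp: order_chars_def)
  obtain p q where "xs = p @ x # q" using split_list[OF x(1)] by blast
  then show "c \<in> word_chars (map (col X) xs)"
    using points_split[OF X, of p x q] xs x(2)
      word_charsI[of "map (col X) xs" "map (col X) p" "col X x" "map (col X) q"] by simp
next
  fix c assume "c \<in> word_chars (map (col X) xs)"
  then obtain p y q where c: "c = (set p, y, set q)" and "map (col X) xs = p @ y # q"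
    by (auto simp: word_chars_def)
  then obtain p' x q' where "xs = p' @ x # q'" "p = map (col X) p'" "y = col X x"
    "q = map (col X) q'"
    by (auto simp: map_eq_append_conv map_eq_Cons_conv)
  then show "c \<in> order_chars X"
    using points_split[OF X, of p' x q'] xs c by (auto simp: order_chars_def image_iff)
qed

theorem mainTheorem6:
  fixes A :: "'a coloured_order"
  assumes "coloured_linear_order A"
    and "finite (points A)"
    and "inj_on (n_character 2 A) (points A)"
  shows "card (points A) \<le> 70"
proof -
  have A: "coloured_linear_order A" by (rule assms)
  obtain xs where xs: "set xs = points A" "sorted_wrt (lt A) xs" and distinct: "distinct xs"
    using sorted_enumeration[of "points A" "lt A"] assms
    unfolding coloured_linear_order_def by blast
  define w where "w = map (col A) xs"
  have below_chars: "order_chars (below A x) = word_chars (map (col A) p)"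
    and above_chars: "order_chars (above A x) = word_chars (map (col A) q)"
    and lin: "coloured_linear_order (below A x)" "coloured_linear_order (above A x)"
    if "xs = p @ x # q" for p x q
  proof -
    show lin: "coloured_linear_order (below A x)" "coloured_linear_order (above A x)"
      unfolding below_def above_def by (intro coloured_linear_order_subset[OF A]; auto)+
    show "order_chars (below A x) = word_chars (map (col A) p)"
      using order_chars_eq_word_chars[OF lin(1), of p] points_split[OF A, of p x q] xs that
      by (simp add: sorted_wrt_append below_def)
    show "order_chars (above A x) = word_chars (map (col A) q)"
      using order_chars_eq_word_chars[OF lin(2), of q] points_split[OF A, of p x q] xs that
      by (simp add: sorted_wrt_append above_def)
  qed
  have "irreducible_word w"
    unfolding irreducible_word_def
  proof (intro allI impI)
    fix p q p' q' c
    assume split: "w = p @ c # q" "w = p' @ c # q'"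
      and eq: "word_chars p = word_chars p'" "word_chars q = word_chars q'"
    obtain u x v where u: "xs = u @ x # v" "p = map (col A) u" "c = col A x" "q = map (col A) v"
      using split(1) unfolding w_def by (auto simp: map_eq_append_conv map_eq_Cons_conv)
    obtain u' x' v' where u': "xs = u' @ x' # v'" "p' = map (col A) u'" "c = col A x'"
        "q' = map (col A) v'"
      using split(2) unfolding w_def by (auto simp: map_eq_append_conv map_eq_Cons_conv)
    have "n_character 2 A x = n_character 2 A x'"
      unfolding n_character_def
      using ef_class_2_cong[OF lin(1)[OF u(1)] lin(1)[OF u'(1)]]
        ef_class_2_cong[OF lin(2)[OF u(1)] lin(2)[OF u'(1)]]
        below_chars[OF u(1)] below_chars[OF u'(1)] above_chars[OF u(1)] above_chars[OF u'(1)]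
        u u' eq by simp
    moreover have "x \<in> points A" unfolding xs(1)[symmetric] u(1) by simp
    moreover have "x' \<in> points A" unfolding xs(1)[symmetric] u'(1) by simp
    ultimately have "x = x'" by (rule inj_onD[OF assms(3)])
    have "x \<notin> set u" "x \<notin> set v" using distinct unfolding u(1) by simp_all
    moreover have "u @ x # v = u' @ x # v'" using u(1) u'(1) \<open>x = x'\<close> by simp
    ultimately have "u = u'" by (simp add: append_Cons_eq_iff)
    then show "p = p'" using u(2) u'(2) by simp
  qed
  then have "length xs \<le> 70" using irreducible_word_length[of w] by (simp add: w_def)
  then show ?thesis using card_length[of xs] xs(1) by simp
qed

end
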